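(* Let $\alpha_1, A_1, \alpha_2, \gamma_2, A_2 > 0$ and consider the system of difference equations $$x_{n+1}=\frac{\alpha_{1}}{A_{1}+y_{n}},\qquad y_{n+1}=\frac{\alpha_{2}+\gamma_{2}y_{n}}{A_{2}+y_{n}},\qquad n=0,1,2,\dots,$$ with arbitrary nonnegative initial conditions $x_0,y_0$. There is a unique equilibrium, namely $$\left(\frac{2\alpha_{1}}{2A_{1}+\gamma_{2}-A_{2}+\sqrt{\left(\gamma_{2}-A_{2}\right)^{2}+4\alpha_{2}}},\frac{\gamma_{2}-A_{2}+\sqrt{\left(\gamma_{2}-A_{2}\right)^{2}+4\alpha_{2}}}{2}\right),$$ and it is globally asymptotically stable.
   Context: The state space is $[0,\infty)^2$. An equilibrium is a point $(\bar x,\bar y)\in[0,\infty)^2$ such that the constant sequence $(x_n,y_n)=(\bar x,\bar y)$ solves the system. It is globally asymptotically stable if it is Lyapunov stable relative to $[0,\infty)^2$ (for every $\varepsilon>0$ there is $\delta>0$ such that every initial condition in $[0,\infty)^2$ within $\delta$ of $(\bar x,\bar y)$ has its whole orbit within $\varepsilon$ of $(\bar x,\bar y)$) and every solution with initial condition in $[0,\infty)^2$ converges to $(\bar x,\bar y)$. *)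

theory Defs
  imports "HOL-Analysis.Analysis"
begin

definition rational_map ::
  "real \<Rightarrow> real \<Rightarrow> real \<Rightarrow> real \<Rightarrow> real \<Rightarrow> real \<times> real \<Rightarrow> real \<times> real" where
  "rational_map \<alpha>\<^sub>1 A\<^sub>1 \<alpha>\<^sub>2 \<gamma>\<^sub>2 A\<^sub>2 =
     (\<lambda>(x, y). (\<alpha>\<^sub>1 / (A\<^sub>1 + y), (\<alpha>\<^sub>2 + \<gamma>\<^sub>2 * y) / (A\<^sub>2 + y)))"

definition state_space :: "(real \<times> real) set" where
  "state_space = {0..} \<times> {0..}"

definition solves_system :: "('a \<Rightarrow> 'a) \<Rightarrow> (nat \<Rightarrow> 'a) \<Rightarrow> bool" where
  "solves_system F z \<longleftrightarrow> (\<forall>n. z (Suc n) = F (z n))"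

definition is_equilibrium :: "('a \<Rightarrow> 'a) \<Rightarrow> 'a set \<Rightarrow> 'a \<Rightarrow> bool" where
  "is_equilibrium F S p \<longleftrightarrow> p \<in> S \<and> solves_system F (\<lambda>n. p)"

definition lyapunov_stable :: "('a::metric_space \<Rightarrow> 'a) \<Rightarrow> 'a set \<Rightarrow> 'a \<Rightarrow> bool" where
  "lyapunov_stable F S p \<longleftrightarrow>
     (\<forall>\<epsilon>>0. \<exists>\<delta>>0. \<forall>z. solves_system F z \<and> z 0 \<in> S \<and> dist (z 0) p < \<delta>
        \<longrightarrow> (\<forall>n. dist (z n) p < \<epsilon>))"

definition globally_attracting :: "('a::metric_space \<Rightarrow> 'a) \<Rightarrow> 'a set \<Rightarrow> 'a \<Rightarrow> bool" where
  "globally_attracting F S p \<longleftrightarrow>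
     (\<forall>z. solves_system F z \<and> z 0 \<in> S \<longrightarrow> z \<longlonglongrightarrow> p)"

definition globally_asymptotically_stable ::
  "('a::metric_space \<Rightarrow> 'a) \<Rightarrow> 'a set \<Rightarrow> 'a \<Rightarrow> bool" where
  "globally_asymptotically_stable F S p \<longleftrightarrow>
     lyapunov_stable F S p \<and> globally_attracting F S p"

end

theory Submission
  imports Defs
begin

text \<open>
  The second coordinate evolves autonomously under a Moebius map whose fixed points are
  \<open>s > 0\<close> and \<open>- \<alpha> / s < 0\<close>. In the coordinate \<open>(y - s) / (y + \<alpha> / s)\<close> the map is
  multiplication by \<open>(\<gamma> - s) / (A + s)\<close>, which has absolute value less than 1. As the orbit is
  bounded after one step, \<open>y\<close> converges to \<open>s\<close> geometrically, with a constant independent of the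
  initial value. The first coordinate is a Lipschitz function of the previous \<open>y\<close>.
\<close>

text \<open>Here \<open>s\<close> is the larger root of t(A + t) = \<alpha> + \<gamma> t, the
  fixed-point equation of the second coordinate cleared of its denominator. Since \<alpha> > 0, the
  square root exceeds |\<gamma> - A|, which forces \<open>s\<close> to be positive.\<close>

lemma positive_quadratic_root:
  fixes \<alpha> \<gamma> A :: real
  assumes "\<alpha> > 0"
  defines "s \<equiv> (\<gamma> - A + sqrt ((\<gamma> - A)\<^sup>2 + 4 * \<alpha>)) / 2"
  shows "s > 0" and "s * (A + s) = \<alpha> + \<gamma> * s"
proof -
  define r where "r = sqrt ((\<gamma> - A)\<^sup>2 + 4 * \<alpha>)"
  have "sqrt ((\<gamma> - A)\<^sup>2) < r"
    unfolding r_def using assms(1) by (intro real_sqrt_less_mono) simp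
  then have "\<bar>\<gamma> - A\<bar> < r" by simp
  then show "s > 0" unfolding s_def r_def[symmetric] by (simp add: abs_less_iff)
  have r2: "r\<^sup>2 = (\<gamma> - A)\<^sup>2 + 4 * \<alpha>"
    unfolding r_def using assms(1) by (intro real_sqrt_pow2) (auto intro: add_nonneg_nonneg)
  have "r = 2 * s - \<gamma> + A" unfolding s_def r_def[symmetric]
    by (simp add: add_divide_distrib diff_divide_distrib)
  then have "(2 * s - \<gamma> + A)\<^sup>2 = (\<gamma> - A)\<^sup>2 + 4 * \<alpha>" using r2 by simp
  then show "s * (A + s) = \<alpha> + \<gamma> * s" by algebra
qed

lemma riccati_orbit_nonneg:
  fixes \<alpha> \<gamma> A :: real
  assumes "\<alpha> > 0" "\<gamma> > 0" "A > 0" "y 0 \<ge> 0"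
    and step: "\<And>n. y (Suc n) = (\<alpha> + \<gamma> * y n) / (A + y n)"
  shows "y n \<ge> 0"
  using assms by (induction n) (auto intro!: divide_nonneg_nonneg add_nonneg_nonneg)

text \<open>The prefactor does not depend on \<open>y 0\<close>, so one estimate yields both
  stability and attraction. It equals (B + m) / m, where \<open>B\<close> bounds the orbit after one
  step and \<open>m\<close> bounds \<open>y 0 + m\<close> from below.\<close>

lemma riccati_orbit_bound:
  fixes \<alpha> \<gamma> A s :: real
  assumes pos: "\<alpha> > 0" "\<gamma> > 0" "A > 0" "s > 0" "y 0 \<ge> 0"
    and fixpoint: "s * (A + s) = \<alpha> + \<gamma> * s"
    and step: "\<And>n. y (Suc n) = (\<alpha> + \<gamma> * y n) / (A + y n)"
  shows "\<bar>y n - s\<bar> \<le> (1 + (\<alpha> / A + \<gamma>) * s / \<alpha>) * \<bar>(\<gamma> - s) / (A + s)\<bar> ^ n * \<bar>y 0 - s\<bar>"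
proof -
  \<comment> \<open>By Vieta, \<open>- m\<close> is the second fixed point; \<open>sm\<close> below
    identifies \<open>m\<close> with \<alpha> / s.\<close>
  define m where "m = A + s - \<gamma>"
  define l where "l = \<bar>(\<gamma> - s) / (A + s)\<bar>"
  define B where "B = \<alpha> / A + \<gamma>"
  have sm: "s * m = \<alpha>" using fixpoint by (simp add: m_def algebra_simps)
  then have m0: "m > 0" using pos by (metis zero_less_mult_pos)
  have y0: "y k \<ge> 0" for k
    using riccati_orbit_nonneg[where y = y, OF pos(1-3,5) step] .
  \<comment> \<open>This is the linearized dynamics of |y - s| / (y + m), with the denominators
    cleared.\<close>
  have conj: "\<bar>y k - s\<bar> * (y 0 + m) = l ^ k * \<bar>y 0 - s\<bar> * (y k + m)" for k
  proof (induction k)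
    case 0
    then show ?case by simp
  next
    case (Suc k)
    have d: "A + y k > 0" "A + s > 0" using y0[of k] pos by auto
    \<comment> \<open>In \<open>e1\<close> and \<open>e2\<close> each fixed point contributes a
      linear factor over the same denominator \<open>A + y k\<close>, which cancels in the quotient
      and leaves the multiplier \<open>l\<close>.\<close>
    have e1: "y (Suc k) - s = (\<gamma> - s) * (y k - s) / (A + y k)"
      using d fixpoint by (simp add: step field_simps)
    have e2: "y (Suc k) + m = (A + s) * (y k + m) / (A + y k)"
      using d sm fixpoint by (simp add: step field_simps m_def)
    have "\<bar>y (Suc k) - s\<bar> * (y 0 + m) = \<bar>\<gamma> - s\<bar> / (A + y k) * (\<bar>y k - s\<bar> * (y 0 + m))"
      using d unfolding e1 by (simp add: abs_mult)
    also have "\<dots> = \<bar>\<gamma> - s\<bar> / (A + y k) * (l ^ k * \<bar>y 0 - s\<bar> * (y k + m))"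
      by (simp only: Suc.IH)
    also have "\<dots> = l ^ Suc k * \<bar>y 0 - s\<bar> * (y (Suc k) + m)"
      using d unfolding e2 by (simp add: l_def)
    finally show ?case .
  qed
  have B0: "B > 0" using pos by (simp add: B_def add_pos_pos)
  have K: "1 + (\<alpha> / A + \<gamma>) * s / \<alpha> = (B + m) / m"
    unfolding B_def[symmetric] using pos m0 by (simp add: sm[symmetric] add_divide_distrib)
  show ?thesis
  proof (cases n)
    case 0
    \<comment> \<open>The initial value may exceed \<open>B\<close>, so index 0 is settled by the
      prefactor being at least 1.\<close>
    moreover have "1 \<le> (B + m) / m" using B0 m0 by simp
    ultimately show ?thesis
      using mult_right_mono[of 1 "(B + m) / m" "\<bar>y 0 - s\<bar>"] unfolding K by simp
  next
    case (Suc k)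
    have "y n \<le> B"
    proof -
      \<comment> \<open>The two summands are bounded separately: the first denominator is at least
        \<open>A\<close>, and the ratio in the second is at most 1.\<close>
      have "y n = \<alpha> / (A + y k) + \<gamma> * (y k / (A + y k))"
        by (simp add: Suc step add_divide_distrib)
      also have "\<dots> \<le> \<alpha> / A + \<gamma> * 1"
        using pos y0[of k]
        by (intro add_mono mult_left_mono divide_left_mono) (auto simp: field_simps intro: add_pos_nonneg)
      finally show ?thesis by (simp add: B_def)
    qed
    have "\<bar>y n - s\<bar> * m \<le> \<bar>y n - s\<bar> * (y 0 + m)"
      using pos by (intro mult_left_mono) auto
    also have "\<dots> \<le> l ^ n * \<bar>y 0 - s\<bar> * (B + m)"
      unfolding conj using \<open>y n \<le> B\<close> by (intro mult_left_mono) (auto simp: l_def)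
    finally show ?thesis
      unfolding K l_def[symmetric] using m0 by (simp add: field_simps)
  qed
qed

text \<open>From A + s - \<gamma> = \<alpha> / s > 0 one gets \<gamma> - s < A < A + s; from
  \<gamma> > 0 one gets s - \<gamma> < s < A + s.\<close>

lemma riccati_multiplier_less_1:
  fixes \<alpha> \<gamma> A s :: real
  assumes "\<alpha> > 0" "\<gamma> > 0" "A > 0" "s > 0" "s * (A + s) = \<alpha> + \<gamma> * s"
  shows "\<bar>(\<gamma> - s) / (A + s)\<bar> < 1"
proof -
  have "s * (A + s - \<gamma>) = \<alpha>" using assms(5) by (simp add: algebra_simps)
  then have "A + s - \<gamma> > 0" using assms by (metis zero_less_mult_pos)
  then show ?thesis using assms by (simp add: abs_if field_simps)
qed

text \<open>The difference is a(s - y) / ((A + y)(A + s)), and both factors of the denominator are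
  at least \<open>A\<close>. This carries the decay of the second coordinate over to the
  first.\<close>

lemma reciprocal_shift_lipschitz:
  fixes a A s y :: real
  assumes "a > 0" "A > 0" "s \<ge> 0" "y \<ge> 0"
  shows "\<bar>a / (A + y) - a / (A + s)\<bar> \<le> a / A\<^sup>2 * \<bar>y - s\<bar>"
proof -
  have d: "A + y > 0" "A + s > 0" using assms by auto
  have "a / (A + y) - a / (A + s) = a * (s - y) / ((A + y) * (A + s))"
    using d by (simp add: field_simps)
  then have "\<bar>a / (A + y) - a / (A + s)\<bar> = a * \<bar>y - s\<bar> / ((A + y) * (A + s))"
    using d assms by (simp add: abs_mult abs_minus_commute)
  also have "\<dots> \<le> a * \<bar>y - s\<bar> / (A * A)"
    using assms d by (intro divide_left_mono mult_mono) auto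
  finally show ?thesis by (simp add: power2_eq_square)
qed

theorem theorem16:
  fixes \<alpha>\<^sub>1 A\<^sub>1 \<alpha>\<^sub>2 \<gamma>\<^sub>2 A\<^sub>2 :: real
  assumes "\<alpha>\<^sub>1 > 0" and "A\<^sub>1 > 0" and "\<alpha>\<^sub>2 > 0" and "\<gamma>\<^sub>2 > 0" and "A\<^sub>2 > 0"
  defines "F \<equiv> rational_map \<alpha>\<^sub>1 A\<^sub>1 \<alpha>\<^sub>2 \<gamma>\<^sub>2 A\<^sub>2"
    and "E \<equiv> (2 * \<alpha>\<^sub>1 / (2 * A\<^sub>1 + \<gamma>\<^sub>2 - A\<^sub>2 + sqrt ((\<gamma>\<^sub>2 - A\<^sub>2)\<^sup>2 + 4 * \<alpha>\<^sub>2)),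
              (\<gamma>\<^sub>2 - A\<^sub>2 + sqrt ((\<gamma>\<^sub>2 - A\<^sub>2)\<^sup>2 + 4 * \<alpha>\<^sub>2)) / 2)"
  shows "(\<forall>p. is_equilibrium F state_space p \<longleftrightarrow> p = E) \<and>
         globally_asymptotically_stable F state_space E"
proof -
  define s where "s = (\<gamma>\<^sub>2 - A\<^sub>2 + sqrt ((\<gamma>\<^sub>2 - A\<^sub>2)\<^sup>2 + 4 * \<alpha>\<^sub>2)) / 2"
  have s0: "s > 0" and fixpoint: "s * (A\<^sub>2 + s) = \<alpha>\<^sub>2 + \<gamma>\<^sub>2 * s"
    unfolding s_def using positive_quadratic_root[OF assms(3)] by auto
  have denom: "2 * A\<^sub>1 + \<gamma>\<^sub>2 - A\<^sub>2 + sqrt ((\<gamma>\<^sub>2 - A\<^sub>2)\<^sup>2 + 4 * \<alpha>\<^sub>2) = 2 * (A\<^sub>1 + s)"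
    by (simp add: s_def)
  have E: "E = (\<alpha>\<^sub>1 / (A\<^sub>1 + s), s)"
    unfolding E_def denom mult_divide_mult_cancel_left[OF zero_neq_numeral[symmetric]]
    by (simp add: s_def)
  have equilibrium: "is_equilibrium F state_space p \<longleftrightarrow> p = E" for p
  proof (cases p)
    case (Pair x y)
    have "(\<alpha>\<^sub>2 + \<gamma>\<^sub>2 * y) / (A\<^sub>2 + y) = y \<longleftrightarrow> y = s" if "y \<ge> 0"
    proof -
      \<comment> \<open>The other fixed point is the negative of this number, so it lies outside the
        state space.\<close>
      have m0: "A\<^sub>2 + s - \<gamma>\<^sub>2 > 0"
      proof -
        have "s * (A\<^sub>2 + s - \<gamma>\<^sub>2) = \<alpha>\<^sub>2" using fixpoint by (simp add: algebra_simps)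
        then show ?thesis using assms(3) s0 by (metis zero_less_mult_pos)
      qed
      have "(\<alpha>\<^sub>2 + \<gamma>\<^sub>2 * y) / (A\<^sub>2 + y) = y \<longleftrightarrow> \<alpha>\<^sub>2 + \<gamma>\<^sub>2 * y = y * (A\<^sub>2 + y)"
        using that assms(5) by (simp add: divide_eq_eq)
      also have "\<dots> \<longleftrightarrow> (y - s) * (y + (A\<^sub>2 + s - \<gamma>\<^sub>2)) = 0"
      proof -
        have "(y - s) * (y + (A\<^sub>2 + s - \<gamma>\<^sub>2)) = y * (A\<^sub>2 + y) - (\<alpha>\<^sub>2 + \<gamma>\<^sub>2 * y)"
          using fixpoint by algebra
        then show ?thesis by auto
      qed
      also have "\<dots> \<longleftrightarrow> y = s" using that m0 by auto
      finally show ?thesis .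
    qed
    then show ?thesis
      using assms(1,2) s0 Pair
      by (auto simp: is_equilibrium_def solves_system_def state_space_def F_def rational_map_def E)
  qed
  define K where "K = 1 + (\<alpha>\<^sub>2 / A\<^sub>2 + \<gamma>\<^sub>2) * s / \<alpha>\<^sub>2"
  define l where "l = \<bar>(\<gamma>\<^sub>2 - s) / (A\<^sub>2 + s)\<bar>"
  define L where "L = \<alpha>\<^sub>1 / A\<^sub>1\<^sup>2"
  have K1: "K \<ge> 1" using assms s0 by (simp add: K_def)
  have l: "0 \<le> l" "l < 1"
    using riccati_multiplier_less_1[OF assms(3-5) s0 fixpoint] by (simp_all add: l_def)
  have L0: "L \<ge> 0" using assms by (simp add: L_def)
  \<comment> \<open>The exponent lags the index by one because the first coordinate depends on the
    previous \<open>y\<close>. In the factor \<open>L + 1\<close>, \<open>L\<close> comes from the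
    first coordinate and 1 from the second.\<close>
  have decay: "dist (z (Suc n)) E \<le> (L + 1) * K * l ^ n * dist (z 0) E"
    if z: "solves_system F z" "z 0 \<in> state_space" for z n
  proof -
    have step: "z (Suc k) = F (z k)" for k using z(1) by (simp add: solves_system_def)
    define y where "y k = snd (z k)" for k
    have y_step: "y (Suc k) = (\<alpha>\<^sub>2 + \<gamma>\<^sub>2 * y k) / (A\<^sub>2 + y k)" for k
      by (simp add: y_def step F_def rational_map_def split: prod.split)
    have x_step: "fst (z (Suc k)) = \<alpha>\<^sub>1 / (A\<^sub>1 + y k)" for k
      by (simp add: y_def step F_def rational_map_def split: prod.split)
    have init: "y 0 \<ge> 0" using z(2) by (auto simp: y_def state_space_def)
    have y0: "y k \<ge> 0" for k
      using riccati_orbit_nonneg[where y = y, OF assms(3-5) init y_step] .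
    have bound: "\<bar>y k - s\<bar> \<le> K * l ^ k * \<bar>y 0 - s\<bar>" for k
      using riccati_orbit_bound[where y = y, OF assms(3-5) s0 init fixpoint y_step]
      by (simp add: K_def l_def)
    have "\<bar>y (Suc n) - s\<bar> \<le> K * l ^ n * \<bar>y 0 - s\<bar>"
    proof -
      \<comment> \<open>One factor \<open>l\<close> is given away so that both coordinates share the
        same rate.\<close>
      have "l ^ Suc n \<le> l ^ n" using l by (intro power_decreasing) auto
      then have "K * l ^ Suc n * \<bar>y 0 - s\<bar> \<le> K * l ^ n * \<bar>y 0 - s\<bar>"
        using K1 by (intro mult_right_mono mult_left_mono) auto
      with bound[of "Suc n"] show ?thesis by linarith
    qed
    moreover have "\<bar>fst (z (Suc n)) - fst E\<bar> \<le> L * (K * l ^ n * \<bar>y 0 - s\<bar>)"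
    proof -
      have "\<bar>fst (z (Suc n)) - fst E\<bar> \<le> L * \<bar>y n - s\<bar>"
        unfolding x_step E L_def fst_conv
        using reciprocal_shift_lipschitz[OF assms(1,2) less_imp_le[OF s0] y0] .
      also have "\<dots> \<le> L * (K * l ^ n * \<bar>y 0 - s\<bar>)"
        using L0 bound by (intro mult_left_mono)
      finally show ?thesis .
    qed
    moreover have "dist (z (Suc n)) E \<le> \<bar>fst (z (Suc n)) - fst E\<bar> + \<bar>y (Suc n) - s\<bar>"
    proof -
      have "dist (z (Suc n)) E \<le> dist (fst (z (Suc n))) (fst E) + dist (snd (z (Suc n))) (snd E)"
        unfolding dist_prod_def by (rule sqrt_sum_squares_le_sum) auto
      then show ?thesis by (simp add: dist_real_def y_def E)
    qed
    ultimately have "dist (z (Suc n)) E \<le> (L + 1) * K * l ^ n * \<bar>y 0 - s\<bar>"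
      by (simp add: algebra_simps)
    also have "\<dots> \<le> (L + 1) * K * l ^ n * dist (z 0) E"
    proof -
      have "\<bar>y 0 - s\<bar> \<le> dist (z 0) E"
        using dist_snd_le[of "z 0" E] by (simp add: dist_real_def y_def E)
      then show ?thesis using L0 K1 l by (intro mult_left_mono) auto
    qed
    finally show ?thesis .
  qed
  define C where "C = (L + 1) * K"
  \<comment> \<open>As \<open>decay\<close> starts at index 1, this inequality lets the choice of
    \<epsilon> / C for \<delta> cover index 0 as well.\<close>
  have C1: "C \<ge> 1" unfolding C_def using mult_mono[of 1 "L + 1" 1 K] L0 K1 by simp
  have "lyapunov_stable F state_space E"
    unfolding lyapunov_stable_def
  proof (intro allI impI)
    fix \<epsilon> :: real assume "\<epsilon> > 0"
    have "dist (z n) E < \<epsilon>"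
      if z: "solves_system F z \<and> z 0 \<in> state_space \<and> dist (z 0) E < \<epsilon> / C" for z n
    proof -
      have "dist (z n) E \<le> C * dist (z 0) E"
      proof (cases n)
        case 0
        then show ?thesis using C1 by (simp add: mult_le_cancel_right1)
      next
        case (Suc k)
        have "dist (z n) E \<le> C * l ^ k * dist (z 0) E"
          using decay[of z k] z by (simp add: Suc C_def)
        also have "\<dots> \<le> C * 1 * dist (z 0) E"
          using C1 l by (intro mult_right_mono mult_left_mono power_le_one) auto
        finally show ?thesis by simp
      qed
      also have "\<dots> < \<epsilon>" using z C1 by (simp add: field_simps)
      finally show ?thesis .
    qed
    then show "\<exists>\<delta>>0. \<forall>z. solves_system F z \<and> z 0 \<in> state_space \<and> dist (z 0) E < \<delta>
        \<longrightarrow> (\<forall>n. dist (z n) E < \<epsilon>)"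
      using \<open>\<epsilon> > 0\<close> C1 by (intro exI[of _ "\<epsilon> / C"]) auto
  qed
  moreover have "globally_attracting F state_space E"
    unfolding globally_attracting_def
  proof (intro allI impI)
    fix z assume z: "solves_system F z \<and> z 0 \<in> state_space"
    have "(\<lambda>n. C * l ^ n * dist (z 0) E) \<longlonglongrightarrow> C * 0 * dist (z 0) E"
      by (intro tendsto_mult tendsto_const LIMSEQ_realpow_zero l)
    then have "(\<lambda>n. C * l ^ n * dist (z 0) E) \<longlonglongrightarrow> 0" by simp
    \<comment> \<open>The estimate controls the shifted orbit, which has the same limit as the orbit
      itself.\<close>
    then have "(\<lambda>n. dist (z (Suc n)) E) \<longlonglongrightarrow> 0"
      by (rule Lim_null_comparison[rotated]) (use decay z in \<open>simp add: C_def\<close>)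
    then have "(\<lambda>n. z (Suc n)) \<longlonglongrightarrow> E" by (rule tendsto_dist_iff[THEN iffD2])
    then show "z \<longlonglongrightarrow> E" by (simp only: filterlim_sequentially_Suc)
  qed
  ultimately show ?thesis
    using equilibrium by (simp add: globally_asymptotically_stable_def)
qed

end
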